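(* Let $\alpha>0$ be an absolute constant. Let $G_1=([m],[n],E_1)$ and $G_2=([m],[n],E_2)$ be two $(r,\Delta,\alpha\Delta)$-expanders. For each $i\in[m]$ let $C_i$ be a disjunction of literals, one for each variable in $\{x_j : j\in N_{G_1}(i)\}\cup\{y_j: j\in N_{G_2}(i)\}$, with arbitrary signs. Then there are constants $c_1,c_2>0$ depending only on $\alpha$ such that for every deterministic communication protocol $\Pi:\{0,1\}^n\times\{0,1\}^n\to[m]$ of depth $d\le c_1 \Delta r$, \[ \Pr_{(\bm x,\bm y)\sim\{0,1\}^n\times\{0,1\}^n}\big[C_{\Pi(\bm x,\bm y)}(\bm x,\bm y)=0\big]\le d\cdot 2^{-c_2\Delta}+e^{-d}. \]
   Context: A bipartite graph $G=(L,R,E)$ is an $(r,\Delta,\alpha\Delta)$-expander if every vertex in $L$ has degree at most $\Delta$ and every $S\subseteq L$ with $|S|\le r$ satisfies $|N_G(S)|\ge \alpha\Delta|S|$, where $N_G(S)$ is the neighbourhood of $S$. Alice holds $x\in\{0,1\}^n$, Bob holds $y\in\{0,1\}^n$, and $(\bm x,\bm y)$ is uniform. *)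

theory Defs
  imports Complex_Main
begin

definition nbhd :: "(nat \<times> nat) set \<Rightarrow> nat set \<Rightarrow> nat set" where
  "nbhd E S = {j. \<exists>i\<in>S. (i, j) \<in> E}"

definition is_expander ::
  "nat \<Rightarrow> nat \<Rightarrow> (nat \<times> nat) set \<Rightarrow> nat \<Rightarrow> nat \<Rightarrow> real \<Rightarrow> bool" where
  "is_expander m n E r \<Delta> \<alpha> \<longleftrightarrow>
     E \<subseteq> {0..<m} \<times> {0..<n} \<and>
     (\<forall>i\<in>{0..<m}. card (nbhd E {i}) \<le> \<Delta>) \<and>
     (\<forall>S. S \<subseteq> {0..<m} \<and> card S \<le> r \<longrightarrow> real (card (nbhd E S)) \<ge> \<alpha> * real \<Delta> * real (card S))"

text \<open>Deterministic two-party communication protocols (protocol trees).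
Inputs are bit strings of length n, encoded as bool lists. At an Alice node
the next bit is a function of Alice's input x; at a Bob node of Bob's input y
(the history is encoded by the position in the tree). Leaves carry outputs.\<close>

datatype protocol =
    Leaf nat
  | AliceNode "bool list \<Rightarrow> bool" protocol protocol
  | BobNode "bool list \<Rightarrow> bool" protocol protocol

fun run :: "protocol \<Rightarrow> bool list \<Rightarrow> bool list \<Rightarrow> nat" where
  "run (Leaf i) x y = i"
| "run (AliceNode f p q) x y = (if f x then run p x y else run q x y)"
| "run (BobNode g p q) x y = (if g y then run p x y else run q x y)"

fun depth :: "protocol \<Rightarrow> nat" where
  "depth (Leaf i) = 0"
| "depth (AliceNode f p q) = Suc (max (depth p) (depth q))"
| "depth (BobNode g p q) = Suc (max (depth p) (depth q))"

fun outputs :: "protocol \<Rightarrow> nat set" where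
  "outputs (Leaf i) = {i}"
| "outputs (AliceNode f p q) = outputs p \<union> outputs q"
| "outputs (BobNode g p q) = outputs p \<union> outputs q"

definition clause_val ::
  "(nat \<times> nat) set \<Rightarrow> (nat \<times> nat) set \<Rightarrow> (nat \<Rightarrow> nat \<Rightarrow> bool) \<Rightarrow> (nat \<Rightarrow> nat \<Rightarrow> bool)
   \<Rightarrow> nat \<Rightarrow> bool list \<Rightarrow> bool list \<Rightarrow> bool" where
  "clause_val E1 E2 sx sy i x y \<longleftrightarrow>
     (\<exists>j\<in>nbhd E1 {i}. x ! j = sx i j) \<or> (\<exists>j\<in>nbhd E2 {i}. y ! j = sy i j)"

definition unif_prob :: "nat \<Rightarrow> (bool list \<Rightarrow> bool list \<Rightarrow> bool) \<Rightarrow> real" where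
  "unif_prob n P = real (card {(x, y). length x = n \<and> length y = n \<and> P x y}) / 2 ^ (2 * n)"

end

theory Submission
  imports Defs
begin

text \<open>Follow the protocol through rectangles \<open>X \<times> Y\<close>, refining each one so that on Alice's side a set
  \<open>S\<close> of clauses is falsified throughout \<open>X\<close>, while every clause outside the closure of \<open>S\<close> (the
  clauses with fewer than \<open>\<alpha>\<Delta>/2\<close> neighbours outside \<open>N(S)\<close>) is \<^emph>\<open>light\<close>: it is falsified on at most
  a \<open>2\<^bsup>-\<alpha>\<Delta>/4\<^esup>\<close> fraction of \<open>X\<close>; likewise with \<open>T\<close> on Bob's side. Lightness is restored after
  each message by splitting off the part of \<open>X\<close> that falsifies a heavy clause \<open>i\<close> and adding \<open>i\<close> to
  \<open>S\<close>. The potential \<open>\<surd>|X| \<cdot> 2\<^bsup>(n-|N(S)|)/2 + \<alpha>\<Delta>|S|/16\<^esup>\<close> does not grow under such a split and grows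
  by a factor of at most \<open>\<surd>2\<close> per message, and it dominates \<open>|X| \<cdot> 2\<^bsup>\<alpha>\<Delta>|S|/16\<^esup>\<close>; so, except with
  probability \<open>e\<^bsup>-d\<^esup>\<close>, \<open>|S| + |T|\<close> stays below \<open>s = 64d/(\<alpha>\<Delta>)\<close>. Expansion then bounds the two closures
  together by \<open>2s/\<alpha>\<close> clauses. When a clause first enters one closure it is still light on the other
  side, so it is falsified there with probability at most \<open>2\<^bsup>-\<alpha>\<Delta>/4\<^esup>\<close>; a union bound over the closures,
  plus the lightness of an output outside them, gives the remaining term.\<close>

section \<open>Neighbourhoods, bit strings and square-root inequalities\<close>

lemma nbhd_mono: "S \<subseteq> T \<Longrightarrow> nbhd E S \<subseteq> nbhd E T"
  by (auto simp: nbhd_def)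

lemma nbhd_UN: "nbhd E S = (\<Union>i\<in>S. nbhd E {i})"
  by (auto simp: nbhd_def)

lemma card_lists_bool: "card {x :: bool list. length x = n} = 2 ^ n"
  using card_lists_length_eq[of "UNIV :: bool set" n] by simp

lemma finite_lists_bool: "finite {x :: bool list. length x = n}"
  using finite_lists_length_eq[of "UNIV :: bool set" n] by simp

lemma sqrt_add_le_sqrt2:
  assumes "0 \<le> a" "0 \<le> b"
  shows "sqrt a + sqrt b \<le> sqrt 2 * sqrt (a + b)"
proof -
  have "(sqrt a + sqrt b)\<^sup>2 \<le> 2 * (a + b)"
    using assms sum_squares_bound[of "sqrt a" "sqrt b"] by (simp add: power2_sum)
  then show ?thesis
    using real_le_rsqrt by (simp add: real_sqrt_mult[symmetric])
qed

text \<open>The tangent bound sqrt (1 - t) \<le> 1 - t / 2 at t = b / a, scaled by sqrt a.\<close>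

lemma sqrt_diff_le:
  assumes "0 \<le> b" "b \<le> a" "0 < a"
  shows "sqrt (a - b) \<le> sqrt a * (1 - b / a / 2)"
proof -
  have "(sqrt a * (1 - b / a / 2))\<^sup>2 = a * (1 - b / a / 2)\<^sup>2"
    using assms by (simp add: power_mult_distrib)
  also have "\<dots> = a - b + b * b / (4 * a)"
    using assms by (simp add: field_simps power2_eq_square)
  finally have "a - b \<le> (sqrt a * (1 - b / a / 2))\<^sup>2"
    using assms by simp
  moreover have "0 \<le> sqrt a * (1 - b / a / 2)"
    using assms by (simp add: field_simps)
  ultimately show ?thesis
    by (metis real_le_lsqrt)
qed

lemma outputs_nonempty: "outputs \<Pi> \<noteq> {}"
  by (induction \<Pi>) auto

lemma unif_prob_le_1: "unif_prob n P \<le> 1"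
proof -
  let ?L = "{x :: bool list. length x = n}"
  have "card {(x, y). length x = n \<and> length y = n \<and> P x y} \<le> card (?L \<times> ?L)"
    using finite_lists_bool[of n] by (intro card_mono) auto
  also have "\<dots> = 2 ^ (2 * n)"
    by (simp add: card_cartesian_product card_lists_bool power_add[symmetric] mult_2)
  finally have "real (card {(x, y). length x = n \<and> length y = n \<and> P x y}) \<le> real (2 ^ (2 * n))"
    by (rule of_nat_mono)
  then show ?thesis
    by (simp add: unif_prob_def)
qed

section \<open>One player's side: closures, lightness and the potential\<close>

locale expander_clauses =
  fixes m n r \<Delta> :: nat and \<alpha> :: real and E :: "(nat \<times> nat) set" and sg :: "nat \<Rightarrow> nat \<Rightarrow> bool"
  assumes expander: "is_expander m n E r \<Delta> \<alpha>"
    and alpha_pos: "0 < \<alpha>" and alpha_le_1: "\<alpha> \<le> 1"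
    and large: "16 \<le> \<alpha> * real \<Delta>"
begin

definition falsifying :: "nat \<Rightarrow> bool list set" where
  "falsifying i = {x. length x = n \<and> (\<forall>j\<in>nbhd E {i}. x ! j \<noteq> sg i j)}"

text \<open>The separate length condition makes \<open>cyl {}\<close> the whole cube, where the
  protocol starts.\<close>

definition cyl :: "nat set \<Rightarrow> bool list set" where
  "cyl S = {x. length x = n \<and> (\<forall>i\<in>S. x \<in> falsifying i)}"

definition cl :: "nat set \<Rightarrow> nat set" where
  "cl S = {i. i < m \<and> real (card (nbhd E {i} - nbhd E S)) < \<alpha> * \<Delta> / 2}"

definition light :: "bool list set \<Rightarrow> nat set \<Rightarrow> bool" where
  "light X S \<longleftrightarrow> (\<forall>i<m. i \<notin> cl S \<longrightarrow>
     real (card (X \<inter> falsifying i)) \<le> 2 powr (- \<alpha> * \<Delta> / 4) * card X)"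

text \<open>Without the weight for S this is the geometric mean of |X| and 2^(n - |N(S)|), which
  bounds the size of any subset of \<open>cyl S\<close>.\<close>

definition pot :: "bool list set \<Rightarrow> nat set \<Rightarrow> real" where
  "pot X S = sqrt (card X) * 2 powr ((real n - card (nbhd E S)) / 2 + \<alpha> * \<Delta> / 16 * card S)"

lemma nbhd_bounded: "nbhd E S \<subseteq> {0..<n}"
  using expander by (auto simp: is_expander_def nbhd_def)

lemma finite_nbhd [simp]: "finite (nbhd E S)"
  using nbhd_bounded finite_subset by blast

lemma card_nbhd_le: "i < m \<Longrightarrow> card (nbhd E {i}) \<le> \<Delta>"
  using expander by (auto simp: is_expander_def)

lemma expansion: "S \<subseteq> {0..<m} \<Longrightarrow> card S \<le> r \<Longrightarrow> \<alpha> * \<Delta> * card S \<le> card (nbhd E S)"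
  using expander by (auto simp: is_expander_def)

lemma finite_cyl [simp]: "finite (cyl S)"
  by (rule finite_subset[OF _ finite_lists_bool[of n]]) (auto simp: cyl_def)

lemma cl_subset: "cl S \<subseteq> {0..<m}"
  by (auto simp: cl_def)

lemma finite_cl [simp]: "finite (cl S)"
  using cl_subset finite_subset by blast

lemma subset_cl: "S \<subseteq> {0..<m} \<Longrightarrow> S \<subseteq> cl S"
proof
  fix i assume *: "S \<subseteq> {0..<m}" "i \<in> S"
  then have "card (nbhd E {i} - nbhd E S) = 0"
    using nbhd_mono[of "{i}" S E] by (simp add: Diff_eq_empty_iff[THEN iffD2])
  then have "real (card (nbhd E {i} - nbhd E S)) < \<alpha> * \<Delta> / 2"
    using large by linarith
  then show "i \<in> cl S"
    using * by (auto simp: cl_def)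
qed

lemma cl_mono:
  assumes "S \<subseteq> T" shows "cl S \<subseteq> cl T"
proof
  fix i assume "i \<in> cl S"
  moreover have "card (nbhd E {i} - nbhd E T) \<le> card (nbhd E {i} - nbhd E S)"
    using nbhd_mono[OF assms, of E] by (intro card_mono) auto
  ultimately show "i \<in> cl T"
    by (auto simp: cl_def)
qed

text \<open>Otherwise take U between S and its closure, of size k \<le> r just above 2|S|/\<alpha>.
  Clauses of U - S have fewer than \<alpha>\<Delta>/2 neighbours outside N(S), so |N(U)| \<le>
  |S|\<Delta> + k\<alpha>\<Delta>/2; expansion demands \<alpha>\<Delta>k, which forces k \<le>
  2|S|/\<alpha>.\<close>

lemma card_cl_le:
  assumes S: "S \<subseteq> {0..<m}" and small: "2 * real (card S) / \<alpha> < r"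
  shows "card (cl S) \<le> 2 * real (card S) / \<alpha>"
proof (rule ccontr)
  assume neg: "\<not> ?thesis"
  define k where "k = nat \<lfloor>2 * real (card S) / \<alpha>\<rfloor> + 1"
  have k: "2 * real (card S) / \<alpha> < k" "k \<le> r" "k \<le> card (cl S)"
  proof -
    have "real (nat \<lfloor>2 * real (card S) / \<alpha>\<rfloor>) \<le> 2 * real (card S) / \<alpha>"
      using alpha_pos by (intro of_nat_floor) simp
    then show "2 * real (card S) / \<alpha> < k" "k \<le> r" "k \<le> card (cl S)"
      using neg small unfolding k_def by linarith+
  qed
  have fin: "finite S"
    using S finite_subset by blast
  have "real (card S) \<le> 2 * real (card S) / \<alpha>"
    using alpha_pos alpha_le_1 mult_left_mono[of \<alpha> 2 "real (card S)"] by (simp add: field_simps)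
  then have Sk: "card S \<le> k"
    using k by linarith
  obtain U where U: "S \<subseteq> U" "U \<subseteq> cl S" "card U = k"
    using exists_subset_between[OF Sk k(3) subset_cl[OF S] finite_cl] by blast
  have finU: "finite U"
    using U(2) finite_cl finite_subset by blast
  have "card (nbhd E S) \<le> (\<Sum>i\<in>S. card (nbhd E {i}))"
    by (subst nbhd_UN) (rule card_UN_le[OF fin])
  also have "\<dots> \<le> card S * \<Delta>"
    using S card_nbhd_le sum_bounded_above[of S "\<lambda>i. card (nbhd E {i})" \<Delta>] by force
  finally have NS: "real (card (nbhd E S)) \<le> card S * \<Delta>"
    by (metis of_nat_le_iff of_nat_mult)
  have "nbhd E U = nbhd E S \<union> (\<Union>i\<in>U - S. nbhd E {i} - nbhd E S)"
    using U(1) by (auto simp: nbhd_def)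
  then have "card (nbhd E U) \<le> card (nbhd E S) + card (\<Union>i\<in>U - S. nbhd E {i} - nbhd E S)"
    by (metis card_Un_le)
  also have "\<dots> \<le> card (nbhd E S) + (\<Sum>i\<in>U - S. card (nbhd E {i} - nbhd E S))"
    using finU by (intro add_left_mono card_UN_le) auto
  finally have "real (card (nbhd E U)) \<le> card (nbhd E S) + (\<Sum>i\<in>U - S. real (card (nbhd E {i} - nbhd E S)))"
    by (metis of_nat_add of_nat_le_iff of_nat_sum)
  also have "(\<Sum>i\<in>U - S. real (card (nbhd E {i} - nbhd E S))) \<le> (\<Sum>i\<in>U - S. \<alpha> * \<Delta> / 2)"
    using U(2) by (intro sum_mono) (auto simp: cl_def dest!: subsetD)
  also have "\<dots> \<le> k * (\<alpha> * \<Delta> / 2)"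
    using large U(3) card_mono[OF finU Diff_subset, of S] by (simp add: mult_right_mono)
  finally have "real (card (nbhd E U)) \<le> card S * \<Delta> + k * (\<alpha> * \<Delta> / 2)"
    using NS by linarith
  moreover have "\<alpha> * \<Delta> * k \<le> card (nbhd E U)"
    using expansion[of U] U k cl_subset by blast
  ultimately have "\<Delta> * (\<alpha> * k) \<le> \<Delta> * (2 * card S)"
    by (simp add: algebra_simps)
  moreover have "0 < real \<Delta>"
    using large by (cases "\<Delta> = 0") auto
  ultimately have "\<alpha> * k \<le> 2 * card S"
    by simp
  then show False
    using k(1) alpha_pos by (simp add: field_simps)
qed

text \<open>Falsifying every clause of S forces each coordinate in N(S), so a string in X is
  determined by its true positions outside N(S).\<close>

lemma card_cyl_le:
  assumes "X \<subseteq> cyl S"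
  shows "real (card X) \<le> 2 powr (real n - card (nbhd E S))"
proof -
  let ?D = "{0..<n} - nbhd E S"
  have "inj_on (\<lambda>x. {j \<in> ?D. x ! j}) X"
  proof (rule inj_onI)
    fix x y assume *: "x \<in> X" "y \<in> X" "{j \<in> ?D. x ! j} = {j \<in> ?D. y ! j}"
    then have xy: "x \<in> cyl S" "y \<in> cyl S"
      using assms by auto
    show "x = y"
    proof (rule nth_equalityI)
      show "length x = length y"
        using xy by (simp add: cyl_def)
    next
      fix j assume "j < length x"
      then have j: "j < n"
        using xy by (simp add: cyl_def)
      show "x ! j = y ! j"
      proof (cases "j \<in> nbhd E S")
        case True
        then obtain i where "i \<in> S" "j \<in> nbhd E {i}"
          by (auto simp: nbhd_def)
        then show ?thesis
          using xy by (auto simp: cyl_def falsifying_def)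
      next
        case False
        then show ?thesis
          using *(3) j by auto
      qed
    qed
  qed
  then have "card X \<le> card (Pow ?D)"
    by (rule card_inj_on_le) auto
  also have "\<dots> = 2 ^ (n - card (nbhd E S))"
    using nbhd_bounded[of S] by (simp add: card_Pow card_Diff_subset)
  finally have "real (card X) \<le> 2 ^ (n - card (nbhd E S))"
    by (metis of_nat_le_iff of_nat_numeral of_nat_power)
  moreover have "card (nbhd E S) \<le> n"
    using card_mono[OF _ nbhd_bounded[of S]] by simp
  ultimately show ?thesis
    by (simp add: powr_realpow[symmetric] of_nat_diff)
qed

lemma pot_nonneg [simp]: "0 \<le> pot X S"
  by (simp add: pot_def)

lemma pot_ge:
  assumes "X \<subseteq> cyl S"
  shows "card X * 2 powr (\<alpha> * \<Delta> / 16 * card S) \<le> pot X S"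
proof -
  let ?c = "2 powr ((real n - card (nbhd E S)) / 2)"
  have "sqrt (card X) \<le> ?c"
    using card_cyl_le[OF assms] real_sqrt_le_mono[of "card X" "2 powr (real n - card (nbhd E S))"]
    by (simp add: powr_half_sqrt[symmetric] powr_powr)
  then have "sqrt (card X) * sqrt (card X) \<le> sqrt (card X) * ?c"
    by (rule mult_left_mono) simp
  then show ?thesis
    by (simp add: pot_def powr_add mult.assoc[symmetric] mult_right_mono)
qed

lemma pot_split:
  assumes "finite X"
  shows "pot {x \<in> X. P x} S + pot {x \<in> X. \<not> P x} S \<le> sqrt 2 * pot X S"
proof -
  have "card X = card {x \<in> X. P x} + card {x \<in> X. \<not> P x}"
    using assms by (subst card_Un_disjoint[symmetric]) (auto intro!: arg_cong[of _ _ card])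
  then have "sqrt (card {x \<in> X. P x}) + sqrt (card {x \<in> X. \<not> P x}) \<le> sqrt 2 * sqrt (card X)"
    using sqrt_add_le_sqrt2[of "card {x \<in> X. P x}" "card {x \<in> X. \<not> P x}"] by simp
  then show ?thesis
    unfolding pot_def distrib_right[symmetric] mult.assoc[symmetric]
    by (rule mult_right_mono) simp
qed

text \<open>Fixing a heavy clause outside the closure reveals at least \<open>\<alpha>\<Delta>/2\<close> new coordinates but costs
  only \<open>\<alpha>\<Delta>/4\<close> bits of density, which pays for the weight of the enlarged \<open>S\<close>.\<close>

lemma pot_fix:
  assumes X: "finite X" and S: "S \<subseteq> {0..<m}" and i: "i < m" "i \<notin> cl S"
    and heavy: "2 powr (- \<alpha> * \<Delta> / 4) * card X < card (X \<inter> falsifying i)"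
  shows "pot (X \<inter> falsifying i) (insert i S) + pot (X - falsifying i) S \<le> pot X S"
proof -
  \<comment> \<open>The unit of all exponents: heaviness costs at most 4 units of density, at least
    8 units of new coordinates appear, and an element of S weighs 1.\<close>
  let ?b = "\<alpha> * \<Delta> / 16"
  let ?N = "real (card (nbhd E S))"
  define a p where "a = real (card X)" and "p = real (card (X \<inter> falsifying i))"
  define c where "c = 2 powr ((real n - ?N) / 2 + ?b * card S)"
  have pa: "p \<le> a"
    using X by (auto simp: a_def p_def intro: card_mono)
  have p0: "0 < p"
    unfolding p_def by (rule le_less_trans[OF _ heavy]) simp
  have diff: "real (card (X - falsifying i)) = a - p"
    using X card_Diff_subset_Int[of X "falsifying i"] pa by (simp add: a_def p_def of_nat_diff)
  have "i \<notin> S"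
    using i subset_cl[OF S] by auto
  moreover have "finite S"
    using S finite_subset by blast
  ultimately have card_S: "card (insert i S) = Suc (card S)"
    by simp
  have "nbhd E (insert i S) = nbhd E S \<union> (nbhd E {i} - nbhd E S)"
    by (auto simp: nbhd_def)
  then have "card (nbhd E (insert i S)) = card (nbhd E S) + card (nbhd E {i} - nbhd E S)"
    by (metis card_Un_disjoint Diff_disjoint finite_Diff finite_nbhd)
  then have N': "?N + 8 * ?b \<le> real (card (nbhd E (insert i S)))"
    using i by (simp add: cl_def)
  \<comment> \<open>The 8 new units enter the exponent halved, a loss of 4; the weight of
    \<open>i\<close> regains 1, hence -3.\<close>
  have "pot (X \<inter> falsifying i) (insert i S) \<le> sqrt p * 2 powr ((real n - ?N) / 2 + ?b * card S + - (3 * ?b))"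
    unfolding pot_def p_def card_S using N'
    by (intro mult_left_mono powr_mono) (auto simp: field_simps)
  also have "\<dots> = sqrt p * 2 powr (- (3 * ?b)) * c"
    unfolding c_def by (subst powr_add) (simp only: mult_ac)
  \<comment> \<open>Heaviness gives sqrt p \<ge> sqrt a * 2^(-2b), and \<open>large\<close> makes
    the third factor 2^(-b) at most 1/2. So the falsifying part takes at most the share p / (2a) of
    the potential, and the tangent bound leaves the rest at most the complementary share.\<close>
  also have "sqrt p * 2 powr (- (3 * ?b)) \<le> sqrt a * (p / a / 2)"
  proof -
    have "a * (2 powr (- 2 * ?b))\<^sup>2 \<le> p"
      using heavy by (simp add: a_def p_def power2_eq_square powr_add[symmetric] mult.commute)
    then have "sqrt a * 2 powr (- 2 * ?b) \<le> sqrt p"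
      using real_sqrt_le_mono[of "a * (2 powr (- 2 * ?b))\<^sup>2" p] by (simp add: real_sqrt_mult)
    moreover have "2 powr (- ?b) \<le> 2 powr (- 1)"
      using large by (intro powr_mono) auto
    then have "2 powr (- ?b) \<le> 1 / (2::real)"
      by (simp add: powr_minus_divide)
    ultimately have "sqrt a * 2 powr (- 2 * ?b) * 2 powr (- ?b) \<le> sqrt p * (1 / 2)"
      by (intro mult_mono) (use p0 in auto)
    then have "sqrt a * 2 powr (- (3 * ?b)) \<le> sqrt p / 2"
      by (simp add: mult.assoc powr_add[symmetric])
    then have "sqrt p * (sqrt a * 2 powr (- (3 * ?b))) \<le> sqrt p * (sqrt p / 2)"
      using p0 by (intro mult_left_mono) auto
    then have "sqrt a * (sqrt p * 2 powr (- (3 * ?b))) \<le> p / 2"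
      using p0 by (simp add: mult.left_commute)
    then have "sqrt a * (sqrt p * 2 powr (- (3 * ?b))) \<le> sqrt a * (sqrt a * (p / a / 2))"
      using p0 pa by (simp add: mult.assoc[symmetric])
    then show ?thesis
      using p0 pa by (subst (asm) mult_le_cancel_left_pos) auto
  qed
  finally have 1: "pot (X \<inter> falsifying i) (insert i S) \<le> sqrt a * (p / a / 2) * c"
    by (simp add: c_def mult_right_mono)
  have "pot (X - falsifying i) S = sqrt (a - p) * c"
    by (simp add: pot_def c_def diff)
  also have "\<dots> \<le> sqrt a * (1 - p / a / 2) * c"
    using sqrt_diff_le[of p a] p0 pa by (intro mult_right_mono) (auto simp: c_def)
  finally have "pot (X \<inter> falsifying i) (insert i S) + pot (X - falsifying i) S \<le> sqrt a * c"
    using 1 by (simp add: algebra_simps)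
  then show ?thesis
    by (simp add: pot_def c_def a_def)
qed

lemma card_cyl_empty: "card (cyl {}) = 2 ^ n"
  by (simp add: cyl_def card_lists_bool)

lemma pot_full: "pot (cyl {}) {} = 2 ^ n"
proof -
  have "real (card (cyl {})) = 2 powr n"
    by (simp add: card_cyl_empty powr_realpow)
  then have "pot (cyl {}) {} = 2 powr (real n / 2) * 2 powr (real n / 2)"
    by (simp add: pot_def nbhd_def powr_half_sqrt[symmetric] powr_powr)
  then show ?thesis
    by (simp add: powr_add[symmetric] powr_realpow)
qed

text \<open>N({}) is empty, so a clause outside \<open>cl {}\<close> has at least \<alpha>\<Delta>/2
  literals on this side and is falsified on a fraction of at most 2^(-\<alpha>\<Delta>/2).\<close>

lemma light_full: "light (cyl {}) {}"
  unfolding light_def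
proof (intro allI impI)
  fix i assume i: "i < m" "i \<notin> cl {}"
  have "real (card (cyl {} \<inter> falsifying i)) \<le> 2 powr (real n - card (nbhd E {i}))"
    by (rule card_cyl_le) (auto simp: cyl_def)
  also have "\<dots> \<le> 2 powr (- \<alpha> * \<Delta> / 4 + n)"
    using i large by (intro powr_mono) (auto simp: cl_def nbhd_def)
  also have "\<dots> = 2 powr (- \<alpha> * \<Delta> / 4) * card (cyl {})"
    unfolding powr_add by (simp add: card_cyl_empty powr_realpow)
  finally show "real (card (cyl {} \<inter> falsifying i)) \<le> 2 powr (- \<alpha> * \<Delta> / 4) * card (cyl {})" .
qed

end

section \<open>The two players jointly: counting falsified outputs\<close>

locale clause_pair =
  A: expander_clauses m n r \<Delta> \<alpha> E sg + B: expander_clauses m n r \<Delta> \<alpha> E' sg'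
  for m n r \<Delta> \<alpha> E sg E' sg' +
  fixes s :: real
  assumes s_le: "2 * s / \<alpha> \<le> r"
begin

definition bad :: "nat set \<Rightarrow> nat set \<Rightarrow> nat set" where
  "bad S T = A.cl S \<union> B.cl T"

definition missed where
  "missed out X S Y T = {(x, y). x \<in> X \<and> y \<in> Y \<and> out x y \<notin> bad S T \<and>
     x \<in> A.falsifying (out x y) \<and> y \<in> B.falsifying (out x y)}"

text \<open>Outputs in the closures are excluded because they were charged on entering; the first summand
  is the budget left for the clauses that may still enter.\<close>

definition bounded where
  "bounded R out X S Y T \<longleftrightarrow> real (card (missed out X S Y T))
     \<le> 2 powr (- \<alpha> * \<Delta> / 4) * (real (card X) * card Y) * (1 + 2 * s / \<alpha> - card (bad S T))
       + R * (A.pot X S * B.pot Y T)"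

text \<open>Exchanging the players lets the analysis of Alice's messages serve for Bob's.\<close>

lemma clause_pair_swap: "clause_pair m n r \<Delta> \<alpha> E' E s"
  by unfold_locales (rule s_le)

lemma missed_subset: "missed out X S Y T \<subseteq> X \<times> Y"
  by (auto simp: missed_def)

text \<open>Each set has fewer than \<open>s\<close> elements, so \<open>s_le\<close> keeps it in
  the range of the closure bound. This keeps the budget in \<open>bounded\<close> at least
  1.\<close>

lemma card_bad_le:
  assumes "S \<subseteq> {0..<m}" "T \<subseteq> {0..<m}" "card S + card T < s"
  shows "card (bad S T) \<le> 2 * s / \<alpha>"
proof -
  have *: "2 * k / \<alpha> < r" if "k < s" for k
    using that s_le A.alpha_pos by (simp add: field_simps)
  have "card (bad S T) \<le> card (A.cl S) + card (B.cl T)"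
    unfolding bad_def by (rule card_Un_le)
  then have "real (card (bad S T)) \<le> real (card (A.cl S)) + real (card (B.cl T))"
    by linarith
  also have "\<dots> \<le> 2 * real (card S) / \<alpha> + 2 * real (card T) / \<alpha>"
    using assms by (intro add_mono A.card_cl_le B.card_cl_le *) auto
  also have "\<dots> = 2 * (real (card S) + card T) / \<alpha>"
    by (simp add: add_divide_distrib)
  also have "\<dots> \<le> 2 * s / \<alpha>"
    using assms A.alpha_pos by (intro divide_right_mono) auto
  finally show ?thesis .
qed

text \<open>Once |S| + |T| reaches \<open>s\<close>, the weights in the potentials make up for the
  factor \<open>R\<close>, so the whole rectangle can be charged to them.\<close>

lemma card_le_pot:
  assumes "X \<subseteq> A.cyl S" "Y \<subseteq> B.cyl T" "s \<le> card S + card T"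
    and R: "2 powr (- \<alpha> * \<Delta> / 16 * s) \<le> R"
  shows "real (card X) * card Y \<le> R * (A.pot X S * B.pot Y T)"
proof -
  let ?b = "\<alpha> * \<Delta> / 16"
  have "1 \<le> 2 powr (- ?b * s) * 2 powr (?b * (card S + card T))"
    unfolding powr_add[symmetric] using assms(3) A.large
    by (intro ge_one_powr_ge_zero) (auto simp: mult_left_mono)
  also have "\<dots> \<le> R * 2 powr (?b * (card S + card T))"
    using R by (intro mult_right_mono) auto
  finally have "real (card X) * card Y \<le> (real (card X) * card Y) * (R * 2 powr (?b * (card S + card T)))"
    using mult_left_mono[of 1 _ "real (card X) * card Y"] by simp
  also have "\<dots> = R * ((card X * 2 powr (?b * card S)) * (card Y * 2 powr (?b * card T)))"
    by (simp add: powr_add distrib_left)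
  also have "\<dots> \<le> R * (A.pot X S * B.pot Y T)"
    using order_trans[OF _ R, of 0] assms
    by (intro mult_left_mono mult_mono A.pot_ge B.pot_ge) auto
  finally show ?thesis .
qed

text \<open>Pairs on which a clause newly absorbed by the closure of \<open>S\<close> is falsified are rare, because that
  clause is still outside the closure of \<open>T\<close> and hence light for \<open>Y\<close>.\<close>

lemma card_missed_insert:
  assumes fin: "finite X" "finite Y" and Y: "B.light Y T"
  shows "real (card (missed out X S Y T)) \<le> card (missed out X (insert i S) Y T)
    + 2 powr (- \<alpha> * \<Delta> / 4) * (real (card X) * card Y) * (real (card (bad (insert i S) T)) - card (bad S T))"
proof -
  let ?D = "bad (insert i S) T - bad S T"
  have sub: "bad S T \<subseteq> bad (insert i S) T"
    using A.cl_mono[of S "insert i S"] by (auto simp: bad_def)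
  have finD: "finite (bad S T)" "finite (bad (insert i S) T)"
    by (auto simp: bad_def)
  have "missed out X S Y T \<subseteq> missed out X (insert i S) Y T \<union> (\<Union>k\<in>?D. X \<times> (Y \<inter> B.falsifying k))"
    by (auto simp: missed_def)
  moreover have "finite (missed out X (insert i S) Y T)"
    using missed_subset fin by (meson finite_SigmaI finite_subset)
  ultimately have "card (missed out X S Y T)
      \<le> card (missed out X (insert i S) Y T \<union> (\<Union>k\<in>?D. X \<times> (Y \<inter> B.falsifying k)))"
    using fin finD by (intro card_mono) auto
  also have "\<dots> \<le> card (missed out X (insert i S) Y T) + card (\<Union>k\<in>?D. X \<times> (Y \<inter> B.falsifying k))"
    by (rule card_Un_le)
  also have "\<dots> \<le> card (missed out X (insert i S) Y T) + (\<Sum>k\<in>?D. card (X \<times> (Y \<inter> B.falsifying k)))"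
    using finD by (intro add_left_mono card_UN_le) auto
  finally have "real (card (missed out X S Y T))
      \<le> card (missed out X (insert i S) Y T) + (\<Sum>k\<in>?D. real (card (X \<times> (Y \<inter> B.falsifying k))))"
    by (metis of_nat_add of_nat_le_iff of_nat_sum)
  also have "(\<Sum>k\<in>?D. real (card (X \<times> (Y \<inter> B.falsifying k))))
      \<le> (\<Sum>k\<in>?D. 2 powr (- \<alpha> * \<Delta> / 4) * (real (card X) * card Y))"
  proof (rule sum_mono)
    fix k assume "k \<in> ?D"
    then have "k < m" "k \<notin> B.cl T"
      using A.cl_subset[of "insert i S"] B.cl_subset[of T] by (auto simp: bad_def)
    then have "real (card (Y \<inter> B.falsifying k)) \<le> 2 powr (- \<alpha> * \<Delta> / 4) * card Y"
      using Y by (simp add: B.light_def)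
    then have "card X * real (card (Y \<inter> B.falsifying k)) \<le> card X * (2 powr (- \<alpha> * \<Delta> / 4) * card Y)"
      by (intro mult_left_mono) auto
    then show "real (card (X \<times> (Y \<inter> B.falsifying k))) \<le> 2 powr (- \<alpha> * \<Delta> / 4) * (real (card X) * card Y)"
      by (simp add: card_cartesian_product mult_ac)
  qed
  also have "\<dots> = 2 powr (- \<alpha> * \<Delta> / 4) * (real (card X) * card Y)
      * (real (card (bad (insert i S) T)) - card (bad S T))"
    using sub finD by (simp add: card_Diff_subset card_mono of_nat_diff)
  finally show ?thesis
    by simp
qed

text \<open>Heavy clauses are split off until the hypothesis \<open>light\<close> applies. By
  \<open>pot_fix\<close> the total potential does not grow, so \<open>R\<close> stays the same
  however many splits occur.\<close>

lemma bounded_restore: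
  assumes R: "2 powr (- \<alpha> * \<Delta> / 16 * s) \<le> R"
    and Y: "T \<subseteq> {0..<m}" "Y \<subseteq> B.cyl T" "B.light Y T"
    and light: "\<And>X S. \<lbrakk>S \<subseteq> {0..<m}; X \<subseteq> A.cyl S; A.light X S; card S + card T < s\<rbrakk>
      \<Longrightarrow> bounded R out X S Y T"
    and "S \<subseteq> {0..<m}" "X \<subseteq> A.cyl S" "card S + card T < s"
  shows "bounded R out X S Y T"
  using assms(6-)
\<comment> \<open>A split either shrinks X and keeps S, or enlarges S within the m clauses without
  enlarging X.\<close>
proof (induction "card X + (m - card S)" arbitrary: X S rule: less_induct)
  case less
  let ?e = "2 powr (- \<alpha> * \<Delta> / 4)"
  have R0: "0 \<le> R"
    using order_trans[OF _ R, of 0] by simp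
  have finX: "finite X" and finY: "finite Y"
    using less.prems(2) Y(2) A.finite_cyl B.finite_cyl finite_subset by blast+
  show ?case
  proof (cases "A.light X S")
    case True
    then show ?thesis
      using light less.prems by blast
  next
    case False
    then obtain i where i: "i < m" "i \<notin> A.cl S" "?e * card X < card (X \<inter> A.falsifying i)"
      by (auto simp: A.light_def not_le)
    define X1 X2 where "X1 = X \<inter> A.falsifying i" and "X2 = X - A.falsifying i"
    have X12: "X = X1 \<union> X2" "X1 \<inter> X2 = {}" "finite X1" "finite X2"
      using finX by (auto simp: X1_def X2_def)
    then have card_X: "real (card X) = real (card X1) + card X2"
      using card_Un_disjoint by (metis of_nat_add)
    have "0 < real (card X1)"
      unfolding X1_def by (rule le_less_trans[OF _ i(3)]) simp
    then have "card X2 < card X"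
      using card_X by simp
    then have b2: "bounded R out X2 S Y T"
      using less.prems by (intro less.hyps) (auto simp: X2_def)
    let ?K = "1 + 2 * s / \<alpha> - card (bad S T)"
    have K: "0 \<le> ?K"
      using card_bad_le[of S T] less.prems Y by simp
    have iS: "insert i S \<subseteq> {0..<m}" "X1 \<subseteq> A.cyl (insert i S)"
      using i less.prems by (auto simp: X1_def A.cyl_def)
    have b1: "real (card (missed out X1 S Y T)) \<le> ?e * (real (card X1) * card Y) * ?K
        + R * (A.pot X1 (insert i S) * B.pot Y T)"
    proof (cases "card (insert i S) + card T < s")
      case True
      have "card (insert i S) \<le> m"
        using card_mono[OF _ iS(1)] by simp
      moreover have "card (insert i S) = Suc (card S)"
        using i A.subset_cl[OF less.prems(1)] finite_subset[OF less.prems(1)] by (subst card_insert_disjoint) auto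
      moreover have "card X1 \<le> card X"
        using finX by (auto simp: X1_def intro: card_mono)
      ultimately have "bounded R out X1 (insert i S) Y T"
        using True iS by (intro less.hyps) auto
      \<comment> \<open>Adding \<open>i\<close> enlarges the closure and shrinks the budget;
        \<open>card_missed_insert\<close> charges exactly this difference to the clauses that
        entered.\<close>
      then show ?thesis
        using card_missed_insert[OF X12(3) finY Y(3), of out S i] by (simp add: bounded_def algebra_simps)
    next
      case False
      \<comment> \<open>The threshold is reached: there is no recursion, and all of X1 \<times> Y is
        paid by the potential.\<close>
      have "card (missed out X1 S Y T) \<le> card (X1 \<times> Y)"
        using X12 finY by (intro card_mono missed_subset) auto
      then have "real (card (missed out X1 S Y T)) \<le> real (card X1) * card Y"
        by (metis card_cartesian_product of_nat_le_iff of_nat_mult)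
      also have "\<dots> \<le> R * (A.pot X1 (insert i S) * B.pot Y T)"
        using False iS Y R by (intro card_le_pot) auto
      moreover have "0 \<le> ?e * (real (card X1) * card Y) * ?K"
        using K by simp
      ultimately show ?thesis
        by linarith
    qed
    have "missed out X S Y T \<subseteq> missed out X1 S Y T \<union> missed out X2 S Y T"
      using X12 by (auto simp: missed_def)
    moreover have "finite (missed out X1 S Y T)" "finite (missed out X2 S Y T)"
      using X12 finY missed_subset by (meson finite_SigmaI finite_subset)+
    ultimately have "card (missed out X S Y T) \<le> card (missed out X1 S Y T) + card (missed out X2 S Y T)"
      by (meson card_Un_le card_mono finite_UnI order_trans)
    then have "real (card (missed out X S Y T))
        \<le> real (card (missed out X1 S Y T)) + card (missed out X2 S Y T)"
      by linarith
    also have "\<dots> \<le> ?e * (real (card X) * card Y) * ?K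
        + R * ((A.pot X1 (insert i S) + A.pot X2 S) * B.pot Y T)"
      using b1 b2 unfolding bounded_def card_X by (simp add: algebra_simps)
    also have "R * ((A.pot X1 (insert i S) + A.pot X2 S) * B.pot Y T) \<le> R * (A.pot X S * B.pot Y T)"
      using A.pot_fix[OF finX less.prems(1) i] R0
      by (intro mult_left_mono mult_right_mono) (auto simp: X1_def X2_def)
    finally show ?thesis
      by (simp add: bounded_def)
  qed
qed

text \<open>The closures do not change, so the first term is additive over the two parts of X; only
  the potential term pays, by \<open>sqrt 2\<close>.\<close>

lemma bounded_split:
  assumes fin: "finite X" "finite Y" and R: "0 \<le> R"
    and 1: "bounded R out1 {x \<in> X. f x} S Y T" and 2: "bounded R out2 {x \<in> X. \<not> f x} S Y T"
  shows "bounded (sqrt 2 * R) (\<lambda>x y. if f x then out1 x y else out2 x y) X S Y T" (is "bounded _ ?out _ _ _ _")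
proof -
  let ?X1 = "{x \<in> X. f x}" and ?X2 = "{x \<in> X. \<not> f x}"
  have "X = ?X1 \<union> ?X2"
    by auto
  then have "card X = card ?X1 + card ?X2"
    using fin by (metis (no_types, lifting) card_Un_disjoint disjoint_iff finite_Un mem_Collect_eq)
  then have card_X: "real (card X) = real (card ?X1) + card ?X2"
    by simp
  have "missed ?out X S Y T = missed out1 ?X1 S Y T \<union> missed out2 ?X2 S Y T"
    by (auto simp: missed_def)
  then have "card (missed ?out X S Y T) \<le> card (missed out1 ?X1 S Y T) + card (missed out2 ?X2 S Y T)"
    by (metis card_Un_le)
  then have "real (card (missed ?out X S Y T))
      \<le> real (card (missed out1 ?X1 S Y T)) + card (missed out2 ?X2 S Y T)"
    by linarith
  also have "\<dots> \<le> 2 powr (- \<alpha> * \<Delta> / 4) * (real (card X) * card Y) * (1 + 2 * s / \<alpha> - card (bad S T))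
      + R * ((A.pot ?X1 S + A.pot ?X2 S) * B.pot Y T)"
    using 1 2 unfolding bounded_def card_X by (simp add: algebra_simps)
  also have "R * ((A.pot ?X1 S + A.pot ?X2 S) * B.pot Y T) \<le> R * ((sqrt 2 * A.pot X S) * B.pot Y T)"
    using R fin by (intro mult_left_mono mult_right_mono A.pot_split) auto
  finally show ?thesis
    by (simp add: bounded_def mult_ac)
qed

lemma bounded_mono:
  assumes "bounded R out X S Y T" "R \<le> R'"
  shows "bounded R' out X S Y T"
  using assms mult_right_mono[of R R' "A.pot X S * B.pot Y T"] by (simp add: bounded_def)

text \<open>A message may destroy lightness, but only on the speaker's side.
  \<open>bounded_restore\<close> recovers it on both parts, so the hypothesis on the subtrees need
  only treat light sets.\<close>

lemma bounded_step:
  assumes R: "2 powr (- \<alpha> * \<Delta> / 16 * s) \<le> R"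
    and Y: "T \<subseteq> {0..<m}" "Y \<subseteq> B.cyl T" "B.light Y T"
    and IH: "\<And>X S out. \<lbrakk>out \<in> {out1, out2}; S \<subseteq> {0..<m}; X \<subseteq> A.cyl S; A.light X S; card S + card T < s\<rbrakk>
      \<Longrightarrow> bounded R out X S Y T"
    and X: "S \<subseteq> {0..<m}" "X \<subseteq> A.cyl S" "card S + card T < s"
  shows "bounded (sqrt 2 * R) (\<lambda>x y. if f x then out1 x y else out2 x y) X S Y T"
proof (rule bounded_split)
  show "finite X" "finite Y"
    using X(2) Y(2) A.finite_cyl B.finite_cyl finite_subset by blast+
  show "0 \<le> R"
    using order_trans[OF _ R, of 0] by simp
  have *: "bounded R out X' S Y T" if out: "out \<in> {out1, out2}" and X': "X' \<subseteq> X" for out X'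
  proof (rule bounded_restore[OF R Y])
    show "S \<subseteq> {0..<m}" "X' \<subseteq> A.cyl S" "card S + card T < s"
      using X X' by auto
  qed (rule IH[OF out])
  show "bounded R out1 {x \<in> X. f x} S Y T" "bounded R out2 {x \<in> X. \<not> f x} S Y T"
    by (rule *; auto)+
qed

lemma bounded_run:
  assumes "outputs \<Pi> \<subseteq> {0..<m}"
    and "S \<subseteq> {0..<m}" "X \<subseteq> A.cyl S" "A.light X S"
    and "T \<subseteq> {0..<m}" "Y \<subseteq> B.cyl T" "B.light Y T"
    and "card S + card T < s"
  shows "bounded (sqrt 2 ^ depth \<Pi> * 2 powr (- \<alpha> * \<Delta> / 16 * s)) (run \<Pi>) X S Y T"
  using assms
proof (induction \<Pi> arbitrary: X S Y T)
  case (Leaf i)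
  let ?e = "2 powr (- \<alpha> * \<Delta> / 4)"
  have fin: "finite X" "finite Y"
    using Leaf.prems A.finite_cyl B.finite_cyl finite_subset by blast+
  \<comment> \<open>The constant 1 in the budget is reserved for the output clause itself.\<close>
  have K: "1 \<le> 1 + 2 * s / \<alpha> - card (bad S T)"
    using card_bad_le[of S T] Leaf.prems by simp
  have "real (card (missed (run (Leaf i)) X S Y T)) \<le> ?e * (real (card X) * card Y) * 1"
  proof (cases "i \<in> bad S T")
    case True
    then show ?thesis
      by (simp add: missed_def)
  next
    case False
    have "card (missed (run (Leaf i)) X S Y T) \<le> card ((X \<inter> A.falsifying i) \<times> Y)"
      using fin by (intro card_mono) (auto simp: missed_def)
    then have "real (card (missed (run (Leaf i)) X S Y T)) \<le> card (X \<inter> A.falsifying i) * real (card Y)"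
      by (metis card_cartesian_product of_nat_le_iff of_nat_mult)
    also have "\<dots> \<le> (?e * card X) * card Y"
      using Leaf.prems False by (intro mult_right_mono) (auto simp: A.light_def bad_def)
    finally show ?thesis
      by (simp add: mult_ac)
  qed
  also have "\<dots> \<le> ?e * (real (card X) * card Y) * (1 + 2 * s / \<alpha> - card (bad S T))"
    using K by (intro mult_left_mono) auto
  finally show ?case
    unfolding bounded_def by (rule order_trans) simp
next
  case (AliceNode f p q)
  let ?R = "sqrt 2 ^ max (depth p) (depth q) * 2 powr (- \<alpha> * \<Delta> / 16 * s)"
  \<comment> \<open>Subtrees may be shallower than the maximum; k = 0 gives the lower bound on
    \<open>?R\<close> that \<open>bounded_step\<close> requires.\<close>
  have mono: "sqrt 2 ^ k * 2 powr (- \<alpha> * \<Delta> / 16 * s) \<le> ?R" if "k \<le> max (depth p) (depth q)" for k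
    using that by (intro mult_right_mono power_increasing) auto
  have "bounded (sqrt 2 * ?R) (\<lambda>x y. if f x then run p x y else run q x y) X S Y T"
  proof (rule bounded_step)
    fix X S out
    assume *: "out \<in> {run p, run q}" "S \<subseteq> {0..<m}" "X \<subseteq> A.cyl S" "A.light X S" "card S + card T < s"
    then show "bounded ?R out X S Y T"
      using AliceNode.prems AliceNode.IH(1)[THEN bounded_mono[OF _ mono], of S X T Y]
        AliceNode.IH(2)[THEN bounded_mono[OF _ mono], of S X T Y] by auto
  qed (use AliceNode.prems mono[of 0] in auto)
  moreover have "run (AliceNode f p q) = (\<lambda>x y. if f x then run p x y else run q x y)"
    by (intro ext) simp
  ultimately show ?case
    by (simp add: mult_ac)
next
  case (BobNode f p q)
  interpret swap: clause_pair m n r \<Delta> \<alpha> E' sg' E sg s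
    by (rule clause_pair_swap)
  \<comment> \<open>Transposing the rectangle preserves the count, so Bob's node becomes Alice's
    node of the exchanged pair.\<close>
  have swap_bounded: "swap.bounded R (\<lambda>y x. out x y) Y T X S = bounded R out X S Y T" for R out X S Y T
  proof -
    have "swap.missed (\<lambda>y x. out x y) Y T X S = prod.swap ` missed out X S Y T"
      by (auto simp: missed_def swap.missed_def bad_def swap.bad_def image_iff)
    then have "card (swap.missed (\<lambda>y x. out x y) Y T X S) = card (missed out X S Y T)"
      by (simp add: card_image)
    then show ?thesis
      by (simp add: bounded_def swap.bounded_def bad_def swap.bad_def Un_commute mult_ac)
  qed
  let ?R = "sqrt 2 ^ max (depth p) (depth q) * 2 powr (- \<alpha> * \<Delta> / 16 * s)"
  have mono: "sqrt 2 ^ k * 2 powr (- \<alpha> * \<Delta> / 16 * s) \<le> ?R" if "k \<le> max (depth p) (depth q)" for k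
    using that by (intro mult_right_mono power_increasing) auto
  have "swap.bounded (sqrt 2 * ?R) (\<lambda>y x. if f y then run p x y else run q x y) Y T X S"
  proof (rule swap.bounded_step)
    fix Y T out
    assume *: "out \<in> {\<lambda>y x. run p x y, \<lambda>y x. run q x y}"
      "T \<subseteq> {0..<m}" "Y \<subseteq> B.cyl T" "B.light Y T" "card T + card S < s"
    then show "swap.bounded ?R out Y T X S"
      using BobNode.prems BobNode.IH(1)[THEN bounded_mono[OF _ mono], of S X T Y]
        BobNode.IH(2)[THEN bounded_mono[OF _ mono], of S X T Y] by (auto simp: swap_bounded add.commute)
  qed (use BobNode.prems mono[of 0] in auto)
  then have "bounded (sqrt 2 * ?R) (\<lambda>x y. if f y then run p x y else run q x y) X S Y T"
    by (subst (asm) swap_bounded)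
  moreover have "run (BobNode f p q) = (\<lambda>x y. if f y then run p x y else run q x y)"
    by (intro ext) simp
  ultimately show ?case
    by (simp add: mult_ac)
qed

lemma unif_prob_le:
  assumes "outputs \<Pi> \<subseteq> {0..<m}" "0 < s"
  shows "unif_prob n (\<lambda>x y. \<not> clause_val E E' sg sg' (run \<Pi> x y) x y)
    \<le> 2 powr (- \<alpha> * \<Delta> / 4) * (1 + 2 * s / \<alpha>) + sqrt 2 ^ depth \<Pi> * 2 powr (- \<alpha> * \<Delta> / 16 * s)"
proof -
  let ?R = "sqrt 2 ^ depth \<Pi> * 2 powr (- \<alpha> * \<Delta> / 16 * s)"
  have "0 < 2 * s / \<alpha>"
    using assms(2) A.alpha_pos by simp
  then have "0 < r"
    using s_le by linarith
  \<comment> \<open>Initially no output is excluded, so \<open>missed\<close> counts every falsified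
    pair.\<close>
  then have "bad {} {} = {}"
    using A.card_cl_le[of "{}"] B.card_cl_le[of "{}"] by (simp add: bad_def)
  then have eq: "missed (run \<Pi>) (A.cyl {}) {} (B.cyl {}) {}
      = {(x, y). length x = n \<and> length y = n \<and> \<not> clause_val E E' sg sg' (run \<Pi> x y) x y}"
    by (auto simp: missed_def clause_val_def A.cyl_def B.cyl_def A.falsifying_def B.falsifying_def)
  have "bounded ?R (run \<Pi>) (A.cyl {}) {} (B.cyl {}) {}"
    using assms by (intro bounded_run A.light_full B.light_full) auto
  then have "real (card {(x, y). length x = n \<and> length y = n \<and> \<not> clause_val E E' sg sg' (run \<Pi> x y) x y})
      \<le> 2 powr (- \<alpha> * \<Delta> / 4) * (2 ^ n * 2 ^ n) * (1 + 2 * s / \<alpha>) + ?R * (2 ^ n * 2 ^ n)"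
    using \<open>bad {} {} = {}\<close>
    by (simp add: bounded_def eq A.pot_full B.pot_full A.card_cyl_empty B.card_cyl_empty)
  also have "\<dots> = (2 powr (- \<alpha> * \<Delta> / 4) * (1 + 2 * s / \<alpha>) + ?R) * 2 ^ (2 * n)"
    by (simp add: algebra_simps power_add[symmetric] mult_2[symmetric])
  finally show ?thesis
    by (simp add: unif_prob_def pos_divide_le_eq)
qed

end

section \<open>Choice of the constants\<close>

theorem mainTheorem3:
  fixes \<alpha> :: real
  assumes "\<alpha> > 0"
  shows "\<exists>c1 c2 :: real. c1 > 0 \<and> c2 > 0 \<and>
    (\<forall>m n r \<Delta> E1 E2 sx sy \<Pi> d.
       is_expander m n E1 r \<Delta> \<alpha> \<longrightarrow> is_expander m n E2 r \<Delta> \<alpha> \<longrightarrow>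
       outputs \<Pi> \<subseteq> {0..<m} \<longrightarrow> depth \<Pi> \<le> d \<longrightarrow>
       real d \<le> c1 * real \<Delta> * real r \<longrightarrow>
       unif_prob n (\<lambda>x y. \<not> clause_val E1 E2 sx sy (run \<Pi> x y) x y)
         \<le> real d * 2 powr (- c2 * real \<Delta>) + exp (- real d))"
proof -
  \<comment> \<open>\<open>M\<close> bounds (1 + 2s/\<alpha>) / d when d and \<Delta> are at least
    1. From \<open>\<Delta>0\<close> on, \<alpha>\<Delta> \<ge> 16 and M \<le>
    2^(\<alpha>\<Delta>/8). \<open>c1\<close> ensures 2s/\<alpha> \<le> r. \<open>c2\<close>
    respects both the rate \<alpha>/8 left after absorbing \<open>M\<close> and the rate making the
    claim trivial below \<open>\<Delta>0\<close>.\<close>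
  define M where "M = 1 + 128 / \<alpha>\<^sup>2"
  define \<Delta>0 where "\<Delta>0 = max (16 / \<alpha>) (8 * log 2 M / \<alpha>)"
  define c1 where "c1 = \<alpha>\<^sup>2 / 128"
  define c2 where "c2 = min (\<alpha> / 8) (1 / (2 * \<Delta>0))"
  have \<Delta>0: "0 < \<Delta>0"
    using assms by (simp add: \<Delta>0_def less_max_iff_disj)
  have c1: "0 < c1" and c2: "0 < c2"
    using assms \<Delta>0 by (auto simp: c1_def c2_def)
  have M: "1 \<le> M"
    by (simp add: M_def)
  show ?thesis
  proof (rule exI[of _ c1], rule exI[of _ c2], intro conjI c1 c2 allI impI)
    fix m n r \<Delta> E1 E2 sx sy \<Pi> d
    assume E1: "is_expander m n E1 r \<Delta> \<alpha>" and E2: "is_expander m n E2 r \<Delta> \<alpha>"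
      and out: "outputs \<Pi> \<subseteq> {0..<m}" and depth: "depth \<Pi> \<le> d" and d: "real d \<le> c1 * real \<Delta> * real r"
    let ?p = "unif_prob n (\<lambda>x y. \<not> clause_val E1 E2 sx sy (run \<Pi> x y) x y)"
    let ?rhs = "real d * 2 powr (- c2 * real \<Delta>) + exp (- real d)"
    have p1: "?p \<le> 1"
      by (rule unif_prob_le_1)
    consider "d = 0" | "1 \<le> d" "\<Delta> < \<Delta>0" | "1 \<le> d" "\<Delta>0 \<le> \<Delta>"
      by linarith
    then show "?p \<le> ?rhs"
    proof cases
      case 1
      then show ?thesis
        using p1 by simp
    next
      case 2
      \<comment> \<open>Here the right-hand side is at least 1: the power is at least 2/3, which
        suffices alone for d \<ge> 2 and together with 1/e \<ge> 1/3 for d = 1.\<close>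
      have "c2 * \<Delta> \<le> 1 / (2 * \<Delta>0) * \<Delta>0"
        using 2 \<Delta>0 c2 by (intro mult_mono) (auto simp: c2_def)
      then have "2 powr (- (1 / 2)) \<le> 2 powr (- c2 * real \<Delta>)"
        using \<Delta>0 by (intro powr_mono) auto
      moreover have "(2::real) / 3 \<le> 2 powr (- (1 / 2))"
        using real_le_rsqrt[of "2 / 3" "1 / 2"]
        by (simp add: powr_minus_divide powr_half_sqrt real_sqrt_divide power2_eq_square)
      ultimately have *: "2 / 3 \<le> 2 powr (- c2 * real \<Delta>)"
        by linarith
      have "1 \<le> ?rhs"
      proof (cases "d = 1")
        case True
        have "1 / 3 \<le> exp (- 1 :: real)"
          using exp_le by (simp add: exp_minus field_simps)
        then show ?thesis
          using True * by simp
      next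
        case False
        then have "2 * (2 / 3) \<le> real d * 2 powr (- c2 * real \<Delta>)"
          using 2 * by (intro mult_mono) auto
        then show ?thesis
          using exp_ge_zero[of "- real d"] by linarith
      qed
      then show ?thesis
        using p1 by linarith
    next
      case 3
      have \<Delta>: "1 \<le> real \<Delta>"
        using 3 \<Delta>0 by (cases \<Delta>) auto
      have large: "16 \<le> \<alpha> * \<Delta>" "8 * log 2 M \<le> \<alpha> * \<Delta>"
        using 3 assms by (auto simp: \<Delta>0_def field_simps)
      have "r \<noteq> 0"
        using d 3 by (cases r) auto
      \<comment> \<open>An output supplies a vertex of the left side; its neighbourhood has at least
        \<alpha>\<Delta> and at most \<Delta> elements, so \<alpha> \<le> 1.\<close>
      obtain i where "i \<in> outputs \<Pi>"
        using outputs_nonempty by blast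
      then have "i < m"
        using out by auto
      then have "\<alpha> * \<Delta> * 1 \<le> card (nbhd E1 {i})" "card (nbhd E1 {i}) \<le> \<Delta>"
        using E1 \<open>r \<noteq> 0\<close> by (auto simp: is_expander_def dest!: spec[of _ "{i}"])
      then have "\<alpha> * \<Delta> \<le> 1 * real \<Delta>"
        by linarith
      then have \<alpha>1: "\<alpha> \<le> 1"
        using \<Delta> by (simp add: mult_le_cancel_right)
      \<comment> \<open>Chosen so that \<alpha>\<Delta>s/16 = 4d; the potential term is then at most
        (sqrt 2 / 16)^d \<le> e^(-d).\<close>
      define s where "s = 64 * d / (\<alpha> * \<Delta>)"
      have s_eq: "2 * s / \<alpha> = 128 / \<alpha>\<^sup>2 * (d / \<Delta>)"
        by (simp add: s_def power2_eq_square)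
      have "real d / \<Delta> \<le> c1 * r"
        using d \<Delta> by (simp add: field_simps)
      then have "128 / \<alpha>\<^sup>2 * (d / \<Delta>) \<le> 128 / \<alpha>\<^sup>2 * (c1 * r)"
        by (rule mult_left_mono) simp
      then have s_le: "2 * s / \<alpha> \<le> r"
        using assms by (simp add: s_eq c1_def)
      have s0: "0 < s"
        using 3 \<Delta> assms by (simp add: s_def)
      interpret clause_pair m n r \<Delta> \<alpha> E1 sx E2 sy s
        using E1 E2 assms \<alpha>1 large s_le by unfold_locales auto
      have "real d / \<Delta> \<le> d"
        using \<Delta> by (simp add: divide_le_eq mult_left_mono[of 1 "real \<Delta>" "real d", simplified])
      then have "128 / \<alpha>\<^sup>2 * (d / \<Delta>) \<le> 128 / \<alpha>\<^sup>2 * d"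
        by (rule mult_left_mono) simp
      then have "1 + 2 * s / \<alpha> \<le> d * M"
        using 3 unfolding s_eq M_def by (simp add: algebra_simps)
      moreover have "M = 2 powr (log 2 M)"
        using M by simp
      moreover have "\<dots> \<le> 2 powr (\<alpha> * \<Delta> / 8)"
        using large by (intro powr_mono) auto
      ultimately have "1 + 2 * s / \<alpha> \<le> d * 2 powr (\<alpha> * \<Delta> / 8)"
        by (smt (verit) mult_left_mono of_nat_0_le_iff)
      then have "2 powr (- \<alpha> * \<Delta> / 4) * (1 + 2 * s / \<alpha>) \<le> 2 powr (- \<alpha> * \<Delta> / 4) * (d * 2 powr (\<alpha> * \<Delta> / 8))"
        by (intro mult_left_mono) auto
      also have "\<dots> = d * 2 powr (- \<alpha> * \<Delta> / 8)"
        by (simp add: mult.left_commute powr_add[symmetric])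
      also have "\<dots> \<le> d * 2 powr (- c2 * \<Delta>)"
        using \<Delta> by (intro mult_left_mono powr_mono) (auto simp: c2_def min_def field_simps)
      finally have 1: "2 powr (- \<alpha> * \<Delta> / 4) * (1 + 2 * s / \<alpha>) \<le> d * 2 powr (- c2 * \<Delta>)" .
      have "- \<alpha> * \<Delta> / 16 * s = - (4 * real d)"
        using assms \<Delta> by (simp add: s_def)
      moreover have "2 powr (- (4 * real d)) = (1 / 16) ^ d"
        by (simp add: powr_minus powr_powr[symmetric] powr_realpow power_one_over inverse_eq_divide)
      moreover have "sqrt 2 ^ depth \<Pi> \<le> sqrt 2 ^ d"
        using depth by (intro power_increasing) auto
      ultimately have "sqrt 2 ^ depth \<Pi> * 2 powr (- \<alpha> * \<Delta> / 16 * s) \<le> sqrt 2 ^ d * (1 / 16) ^ d"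
        by (metis mult_right_mono powr_ge_zero)
      also have "\<dots> = (sqrt 2 * (1 / 16)) ^ d"
        by (simp only: power_mult_distrib)
      also have "\<dots> \<le> exp (- 1) ^ d"
      proof (rule power_mono)
        have "1 / 3 \<le> exp (- 1 :: real)"
          using exp_le by (simp add: exp_minus field_simps)
        then show "sqrt 2 * (1 / 16) \<le> exp (- 1)"
          using sqrt2_less_2 by linarith
      qed simp
      also have "\<dots> = exp (- real d)"
        by (simp add: exp_of_nat_mult[symmetric])
      finally show ?thesis
        using 1 unif_prob_le[OF out s0] by linarith
    qed
  qed
qed

end
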